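(* Let $\mathbf{A}=\langle A,\leq,\cdot,1,+,0\rangle$ be a commutative bimonoid (respectively commutative $\ell$-bimonoid). Let $L=R=A\times A$ and for $X\subseteq L$, $Y\subseteq R$ put $X^{\triangleright}=\{(c,d)\in R: a\cdot d\leq b+c \text{ for all }(a,b)\in X\}$ and $Y^{\triangleleft}=\{(a,b)\in L: a\cdot d\leq b+c\text{ for all }(c,d)\in Y\}$. Let $G$ be the set of all $X\subseteq L$ with $X=X^{\triangleright\triangleleft}$, ordered by inclusion, equipped with the operations $1^{G}=\{(1,0)\}^{\triangleright\triangleleft}$, $0^{G}=\{(0,1)\}^{\triangleleft}$, $X\cdot Y=\{(a\cdot c,b+d):(a,b)\in X,(c,d)\in Y\}^{\triangleright\triangleleft}$, $X+Y=\{(c+c',d\cdot d'):(c,d)\in X^{\triangleright},(c',d')\in Y^{\triangleright}\}^{\triangleleft}$, $X\wedge Y=X\cap Y$, $X\vee Y=(X\cup Y)^{\triangleright\triangleleft}$, and $\overline{X}=\{(b,a):(a,b)\in X\}^{\triangleleft}$. Then $G$ together with the map $a\mapsto\{(a,1)\}^{\triangleleft}=\{(c,d)\in A^2: c\leq d+a\}$ is a commutative complemented Dedekind--MacNeille completion of $\mathbf{A}$. In particular, every commutative (respectively commutative $\ell$-)bimonoid has a commutative complemented Dedekind--MacNeille completion.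
   Context: A bimonoid $\langle A,\leq,\cdot,1,+,0\rangle$ is a poset with two monoid structures ($\cdot$ with unit $1$, $+$ with unit $0$), both operations order preserving in each argument, satisfying hemidistributivity $x\cdot(y+z)\leq(x\cdot y)+z$ and $(z+y)\cdot x\leq z+(y\cdot x)$; commutative if both operations are commutative. A commutative $\ell$-bimonoid is a commutative bimonoid whose order is a lattice such that $x\cdot(y\vee z)=(x\cdot y)\vee(x\cdot z)$ and $x+(y\wedge z)=(x+y)\wedge(x+z)$. Homomorphisms preserve order, $\cdot,1,+,0$; embeddings are homomorphisms that are order embeddings. In a commutative bimonoid, $y$ is a complement of $x$ if $x\cdot y\leq 0$ and $1\leq x+y$; unique if it exists, written $\overline{x}$; complemented means every element has a complement; complete means the order is a complete lattice. An embedding $e\colon\mathbf{A}\hookrightarrow\mathbf{C}$ of commutative bimonoids is a commutative $\Delta_1$-extension if the elements $e(a)\cdot\overline{e(b)}$ ($a,b\in\mathbf{A}$, complement existing in $\mathbf{C}$) are join dense and the elements $e(a)+\overline{e(b)}$ are meet dense in $\mathbf{C}$. A commutative complemented Dedekind--MacNeille completion of $\mathbf{A}$ is a commutative $\Delta_1$-extension $e\colon\mathbf{A}\hookrightarrow\mathbf{C}$ with $\mathbf{C}$ complete and complemented. *)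

theory Defs
  imports "HOL-Algebra.Group"
begin

section \<open>Bimonoids\<close>

record 'a bimonoid = "'a gorder" +
  bmul  :: "['a, 'a] \<Rightarrow> 'a" (infixl \<open>\<odot>\<index>\<close> 70)
  bone  :: 'a
  bplus :: "['a, 'a] \<Rightarrow> 'a" (infixl \<open>\<oplus>\<index>\<close> 65)
  bzero :: 'a

definition mul_monoid :: "('a, 'm) bimonoid_scheme \<Rightarrow> 'a monoid" where
  "mul_monoid B = \<lparr>carrier = carrier B, mult = bmul B, one = bone B\<rparr>"

definition plus_monoid :: "('a, 'm) bimonoid_scheme \<Rightarrow> 'a monoid" where
  "plus_monoid B = \<lparr>carrier = carrier B, mult = bplus B, one = bzero B\<rparr>"

locale bimonoid = partial_order B for B (structure) +
  assumes mul_monoid: "monoid (mul_monoid B)"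
    and plus_monoid: "monoid (plus_monoid B)"
    and mul_mono_left: "\<lbrakk>x \<in> carrier B; y \<in> carrier B; z \<in> carrier B; x \<sqsubseteq> y\<rbrakk> \<Longrightarrow> x \<odot> z \<sqsubseteq> y \<odot> z"
    and mul_mono_right: "\<lbrakk>x \<in> carrier B; y \<in> carrier B; z \<in> carrier B; x \<sqsubseteq> y\<rbrakk> \<Longrightarrow> z \<odot> x \<sqsubseteq> z \<odot> y"
    and plus_mono_left: "\<lbrakk>x \<in> carrier B; y \<in> carrier B; z \<in> carrier B; x \<sqsubseteq> y\<rbrakk> \<Longrightarrow> x \<oplus> z \<sqsubseteq> y \<oplus> z"
    and plus_mono_right: "\<lbrakk>x \<in> carrier B; y \<in> carrier B; z \<in> carrier B; x \<sqsubseteq> y\<rbrakk> \<Longrightarrow> z \<oplus> x \<sqsubseteq> z \<oplus> y"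
    and hemidistrib_left: "\<lbrakk>x \<in> carrier B; y \<in> carrier B; z \<in> carrier B\<rbrakk> \<Longrightarrow> x \<odot> (y \<oplus> z) \<sqsubseteq> (x \<odot> y) \<oplus> z"
    and hemidistrib_right: "\<lbrakk>x \<in> carrier B; y \<in> carrier B; z \<in> carrier B\<rbrakk> \<Longrightarrow> (z \<oplus> y) \<odot> x \<sqsubseteq> z \<oplus> (y \<odot> x)"

locale comm_bimonoid = bimonoid B for B (structure) +
  assumes mul_comm: "\<lbrakk>x \<in> carrier B; y \<in> carrier B\<rbrakk> \<Longrightarrow> x \<odot> y = y \<odot> x"
    and plus_comm: "\<lbrakk>x \<in> carrier B; y \<in> carrier B\<rbrakk> \<Longrightarrow> x \<oplus> y = y \<oplus> x"

locale comm_lbimonoid = comm_bimonoid B + lattice B for B (structure) +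
  assumes mul_join_distrib: "\<lbrakk>x \<in> carrier B; y \<in> carrier B; z \<in> carrier B\<rbrakk>
      \<Longrightarrow> x \<odot> (y \<squnion> z) = (x \<odot> y) \<squnion> (x \<odot> z)"
    and plus_meet_distrib: "\<lbrakk>x \<in> carrier B; y \<in> carrier B; z \<in> carrier B\<rbrakk>
      \<Longrightarrow> x \<oplus> (y \<sqinter> z) = (x \<oplus> y) \<sqinter> (x \<oplus> z)"

definition is_complement :: "('a, 'm) bimonoid_scheme \<Rightarrow> 'a \<Rightarrow> 'a \<Rightarrow> bool" where
  "is_complement B x y \<longleftrightarrow>
     x \<in> carrier B \<and> y \<in> carrier B \<and> x \<odot>\<^bsub>B\<^esub> y \<sqsubseteq>\<^bsub>B\<^esub> bzero B \<and> bone B \<sqsubseteq>\<^bsub>B\<^esub> x \<oplus>\<^bsub>B\<^esub> y"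

definition complement :: "('a, 'm) bimonoid_scheme \<Rightarrow> 'a \<Rightarrow> 'a" where
  "complement B x = (THE y. is_complement B x y)"

definition complemented :: "('a, 'm) bimonoid_scheme \<Rightarrow> bool" where
  "complemented B \<longleftrightarrow> (\<forall>x\<in>carrier B. \<exists>y. is_complement B x y)"

section \<open>Embeddings and completions\<close>

definition bimonoid_hom ::
  "('a, 'm) bimonoid_scheme \<Rightarrow> ('b, 'n) bimonoid_scheme \<Rightarrow> ('a \<Rightarrow> 'b) \<Rightarrow> bool" where
  "bimonoid_hom A C e \<longleftrightarrow>
     e \<in> carrier A \<rightarrow> carrier C \<and>
     (\<forall>x\<in>carrier A. \<forall>y\<in>carrier A. x \<sqsubseteq>\<^bsub>A\<^esub> y \<longrightarrow> e x \<sqsubseteq>\<^bsub>C\<^esub> e y) \<and>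
     (\<forall>x\<in>carrier A. \<forall>y\<in>carrier A. e (x \<odot>\<^bsub>A\<^esub> y) = e x \<odot>\<^bsub>C\<^esub> e y) \<and>
     e (bone A) = bone C \<and>
     (\<forall>x\<in>carrier A. \<forall>y\<in>carrier A. e (x \<oplus>\<^bsub>A\<^esub> y) = e x \<oplus>\<^bsub>C\<^esub> e y) \<and>
     e (bzero A) = bzero C"

definition bimonoid_embedding ::
  "('a, 'm) bimonoid_scheme \<Rightarrow> ('b, 'n) bimonoid_scheme \<Rightarrow> ('a \<Rightarrow> 'b) \<Rightarrow> bool" where
  "bimonoid_embedding A C e \<longleftrightarrow>
     bimonoid_hom A C e \<and>
     (\<forall>x\<in>carrier A. \<forall>y\<in>carrier A. x \<sqsubseteq>\<^bsub>A\<^esub> y \<longleftrightarrow> e x \<sqsubseteq>\<^bsub>C\<^esub> e y)"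

definition join_dense :: "('a, 'm) gorder_scheme \<Rightarrow> 'a set \<Rightarrow> bool" where
  "join_dense L S \<longleftrightarrow> S \<subseteq> carrier L \<and> (\<forall>x\<in>carrier L. \<exists>T\<subseteq>S. least L x (Upper L T))"

definition meet_dense :: "('a, 'm) gorder_scheme \<Rightarrow> 'a set \<Rightarrow> bool" where
  "meet_dense L S \<longleftrightarrow> S \<subseteq> carrier L \<and> (\<forall>x\<in>carrier L. \<exists>T\<subseteq>S. greatest L x (Lower L T))"

definition comm_Delta1_extension ::
  "('a, 'm) bimonoid_scheme \<Rightarrow> ('b, 'n) bimonoid_scheme \<Rightarrow> ('a \<Rightarrow> 'b) \<Rightarrow> bool" where
  "comm_Delta1_extension A C e \<longleftrightarrow>
     comm_bimonoid A \<and> comm_bimonoid C \<and> bimonoid_embedding A C e \<and>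
     (\<forall>b\<in>carrier A. \<exists>y. is_complement C (e b) y) \<and>
     join_dense C {e a \<odot>\<^bsub>C\<^esub> complement C (e b) | a b. a \<in> carrier A \<and> b \<in> carrier A} \<and>
     meet_dense C {e a \<oplus>\<^bsub>C\<^esub> complement C (e b) | a b. a \<in> carrier A \<and> b \<in> carrier A}"

definition comm_complemented_DM_completion ::
  "('a, 'm) bimonoid_scheme \<Rightarrow> ('b, 'n) bimonoid_scheme \<Rightarrow> ('a \<Rightarrow> 'b) \<Rightarrow> bool" where
  "comm_complemented_DM_completion A C e \<longleftrightarrow>
     comm_Delta1_extension A C e \<and> complete_lattice C \<and> complemented C"

text \<open>The \<open>\<ell>\<close>-version: the completion lives in the category of \<open>\<ell>\<close>-bimonoids, so \<open>C\<close> is an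
  \<open>\<ell>\<close>-bimonoid and \<open>e\<close> also preserves binary joins and meets.\<close>

definition comm_complemented_DM_lcompletion ::
  "('a, 'm) bimonoid_scheme \<Rightarrow> ('b, 'n) bimonoid_scheme \<Rightarrow> ('a \<Rightarrow> 'b) \<Rightarrow> bool" where
  "comm_complemented_DM_lcompletion A C e \<longleftrightarrow>
     comm_complemented_DM_completion A C e \<and>
     comm_lbimonoid A \<and> comm_lbimonoid C \<and> join_pres A C e \<and> meet_pres A C e"

section \<open>The bimonoid of Galois-closed sets\<close>

definition rpolar :: "('a, 'm) bimonoid_scheme \<Rightarrow> ('a \<times> 'a) set \<Rightarrow> ('a \<times> 'a) set" where
  "rpolar A X = {(c, d) \<in> carrier A \<times> carrier A. \<forall>(a, b)\<in>X. a \<odot>\<^bsub>A\<^esub> d \<sqsubseteq>\<^bsub>A\<^esub> b \<oplus>\<^bsub>A\<^esub> c}"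

definition lpolar :: "('a, 'm) bimonoid_scheme \<Rightarrow> ('a \<times> 'a) set \<Rightarrow> ('a \<times> 'a) set" where
  "lpolar A Y = {(a, b) \<in> carrier A \<times> carrier A. \<forall>(c, d)\<in>Y. a \<odot>\<^bsub>A\<^esub> d \<sqsubseteq>\<^bsub>A\<^esub> b \<oplus>\<^bsub>A\<^esub> c}"

definition gclosure :: "('a, 'm) bimonoid_scheme \<Rightarrow> ('a \<times> 'a) set \<Rightarrow> ('a \<times> 'a) set" where
  "gclosure A X = lpolar A (rpolar A X)"

definition galois_bimonoid :: "('a, 'm) bimonoid_scheme \<Rightarrow> ('a \<times> 'a) set bimonoid" where
  "galois_bimonoid A =
     \<lparr>carrier = {X. X \<subseteq> carrier A \<times> carrier A \<and> X = gclosure A X},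
      eq = (=),
      le = (\<subseteq>),
      bmul = (\<lambda>X Y. gclosure A {(a \<odot>\<^bsub>A\<^esub> c, b \<oplus>\<^bsub>A\<^esub> d) | a b c d. (a, b) \<in> X \<and> (c, d) \<in> Y}),
      bone = gclosure A {(bone A, bzero A)},
      bplus = (\<lambda>X Y. lpolar A {(c \<oplus>\<^bsub>A\<^esub> c', d \<odot>\<^bsub>A\<^esub> d') | c d c' d'.
                                 (c, d) \<in> rpolar A X \<and> (c', d') \<in> rpolar A Y}),
      bzero = lpolar A {(bzero A, bone A)}\<rparr>"

definition galois_compl :: "('a, 'm) bimonoid_scheme \<Rightarrow> ('a \<times> 'a) set \<Rightarrow> ('a \<times> 'a) set" where
  "galois_compl A X = lpolar A {(b, a) | a b. (a, b) \<in> X}"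

definition galois_embedding :: "('a, 'm) bimonoid_scheme \<Rightarrow> 'a \<Rightarrow> ('a \<times> 'a) set" where
  "galois_embedding A a = lpolar A {(a, bone A)}"

end

theory Submission
  imports Defs
begin

text \<open>
  The pairs \<open>(a, b)\<close>, standing for the formal products of \<open>a\<close> with the complement of \<open>b\<close>, form a
  commutative monoid under \<open>(a, b)(c, d) = (a \<odot> c, b \<oplus> d)\<close>. Together with the pole
  \<open>{(a, b). a \<sqsubseteq> b}\<close> they are a phase space in the sense of linear logic: \<open>a \<odot> d \<sqsubseteq> b \<oplus> c\<close> says
  that the product of \<open>(a, b)\<close> and \<open>(d, c)\<close> lies in the pole. Up to swapping components, both polars
  are thus the orthogonal of the phase space, the complement of a set is its orthogonal, and the
  Galois-closed sets are the facts. The bimonoid laws hold for the facts of any phase space: since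
  \<open>X \<star> Y \<subseteq> orth Z\<close> iff \<open>X \<subseteq> orth (Y \<star> Z)\<close>, the product is residuated, and the sum is its De Morgan
  dual. Hemidistributivity of \<open>A\<close> itself enters only through the two descriptions
  \<open>orth {(1, a)} = orth (orth {(a, 0)})\<close> of the image of \<open>a\<close>, which make the embedding preserve both
  operations.
\<close>

section \<open>Phase spaces\<close>

locale phase_space = comm_monoid M for M :: "('a, 'b) monoid_scheme" (structure) +
  fixes pole :: "'a set"
begin

definition orth :: "'a set \<Rightarrow> 'a set" where
  "orth X = {p \<in> carrier M. \<forall>q\<in>X. p \<otimes> q \<in> pole}"

definition fact :: "'a set \<Rightarrow> bool" where
  "fact X \<longleftrightarrow> X \<subseteq> carrier M \<and> orth (orth X) = X"

definition star :: "'a set \<Rightarrow> 'a set \<Rightarrow> 'a set" (infixl \<open>\<star>\<close> 70) where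
  "X \<star> Y = {x \<otimes> y | x y. x \<in> X \<and> y \<in> Y}"

section \<open>Orthogonality as a Galois connection\<close>

lemma orth_closed: "orth X \<subseteq> carrier M"
  by (auto simp: orth_def)

lemma fact_closed: "fact X \<Longrightarrow> X \<subseteq> carrier M"
  by (simp add: fact_def)

lemma orth_orth_fact: "fact X \<Longrightarrow> orth (orth X) = X"
  by (simp add: fact_def)

lemma orth_antimono: "X \<subseteq> Y \<Longrightarrow> orth Y \<subseteq> orth X"
  by (auto simp: orth_def)

lemma orth_Un: "orth (X \<union> Y) = orth X \<inter> orth Y"
  by (auto simp: orth_def)

text \<open>Commutativity makes orthogonality a symmetric relation, so the single map
  \<open>orth\<close> plays both halves of a Galois connection and \<open>orth \<circ> orth\<close>
  is its closure operator.\<close>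

lemma subset_orth_orth:
  assumes "X \<subseteq> carrier M"
  shows "X \<subseteq> orth (orth X)"
  using assms by (auto simp: orth_def) (metis m_comm subsetD)

lemma orth_orth_orth: "X \<subseteq> carrier M \<Longrightarrow> orth (orth (orth X)) = orth X"
  by (intro equalityI orth_antimono subset_orth_orth orth_closed)

lemma fact_orth: "X \<subseteq> carrier M \<Longrightarrow> fact (orth X)"
  by (simp add: fact_def orth_closed orth_orth_orth)

lemma fact_orth_orth: "fact (orth (orth X))"
  by (rule fact_orth[OF orth_closed])

text \<open>Universal property of the closure: an inclusion into a fact need only be checked on
  generators.\<close>

lemma orth_orth_subset_iff:
  assumes "X \<subseteq> carrier M" "fact Y"
  shows "orth (orth X) \<subseteq> Y \<longleftrightarrow> X \<subseteq> Y"
  using assms by (metis fact_def orth_antimono order_trans subset_orth_orth)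

section \<open>Products of sets and residuation\<close>

lemma star_closed: "X \<subseteq> carrier M \<Longrightarrow> Y \<subseteq> carrier M \<Longrightarrow> X \<star> Y \<subseteq> carrier M"
  by (auto simp: star_def)

lemma star_mono: "X \<subseteq> X' \<Longrightarrow> Y \<subseteq> Y' \<Longrightarrow> X \<star> Y \<subseteq> X' \<star> Y'"
  unfolding star_def by blast

lemma star_comm: "X \<subseteq> carrier M \<Longrightarrow> Y \<subseteq> carrier M \<Longrightarrow> X \<star> Y = Y \<star> X"
  unfolding star_def by (blast intro: m_comm)

lemma star_assoc:
  assumes "X \<subseteq> carrier M" "Y \<subseteq> carrier M" "Z \<subseteq> carrier M"
  shows "X \<star> Y \<star> Z = X \<star> (Y \<star> Z)"
proof -
  have "(x \<otimes> y) \<otimes> z = x \<otimes> (y \<otimes> z)" if "x \<in> X" "y \<in> Y" "z \<in> Z" for x y z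
    using assms that by (intro m_assoc) auto
  then show ?thesis
    unfolding star_def by (auto; metis)
qed

lemma one_star: "X \<subseteq> carrier M \<Longrightarrow> {\<one>} \<star> X = X"
  unfolding star_def by (force simp: subset_iff)

lemma star_singletons: "{p} \<star> {q} = {p \<otimes> q}"
  by (auto simp: star_def)

text \<open>Both sides say that \<open>x \<otimes> y \<otimes> z\<close> lies in the pole for all
  \<open>x\<close>, \<open>y\<close>, \<open>z\<close> from the three sets; only the bracketing
  differs.\<close>

lemma star_subset_orth_iff:
  assumes "X \<subseteq> carrier M" "Y \<subseteq> carrier M" "Z \<subseteq> carrier M"
  shows "X \<star> Y \<subseteq> orth Z \<longleftrightarrow> X \<subseteq> orth (Y \<star> Z)"
proof -
  have "(x \<otimes> y) \<otimes> z = x \<otimes> (y \<otimes> z)" if "x \<in> X" "y \<in> Y" "z \<in> Z" for x y z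
    using assms that by (intro m_assoc) auto
  moreover have "x \<otimes> y \<in> carrier M" if "x \<in> X" "y \<in> Y" for x y
    using assms that by auto
  moreover have "X \<star> Y \<subseteq> orth Z \<longleftrightarrow> (\<forall>x\<in>X. \<forall>y\<in>Y. x \<otimes> y \<in> orth Z)"
    by (auto simp: star_def)
  ultimately have "X \<star> Y \<subseteq> orth Z \<longleftrightarrow> (\<forall>x\<in>X. \<forall>y\<in>Y. \<forall>z\<in>Z. x \<otimes> (y \<otimes> z) \<in> pole)"
    by (simp add: orth_def)
  also have "\<dots> \<longleftrightarrow> X \<subseteq> orth (Y \<star> Z)"
    using assms(1) by (fastforce simp: star_def orth_def)
  finally show ?thesis .
qed

text \<open>Closing a factor is invisible under an outer \<open>orth\<close>. This lets the monoid
  laws of facts be read off from those of \<open>\<star>\<close> on plain sets.\<close>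

lemma orth_star_orth_orth_right:
  assumes X: "X \<subseteq> carrier M" and Y: "Y \<subseteq> carrier M"
  shows "orth (X \<star> orth (orth Y)) = orth (X \<star> Y)"
proof -
  \<comment> \<open>Residuation turns the two sides into
    \<open>W \<star> X \<subseteq> orth (orth (orth Y))\<close> and
    \<open>W \<star> X \<subseteq> orth Y\<close>, where the triple orthogonal collapses. Taking
    \<open>W\<close> to be each of the two orthogonals then gives equality.\<close>
  have "W \<subseteq> orth (X \<star> orth (orth Y)) \<longleftrightarrow> W \<subseteq> orth (X \<star> Y)" if "W \<subseteq> carrier M" for W
    using that X Y
    by (simp add: star_subset_orth_iff[symmetric] orth_closed orth_orth_orth)
  from this[OF orth_closed] show ?thesis
    by blast
qed

lemma orth_star_orth_orth_left:
  assumes "X \<subseteq> carrier M" "Y \<subseteq> carrier M"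
  shows "orth (orth (orth X) \<star> Y) = orth (X \<star> Y)"
  using orth_star_orth_orth_right[OF assms(2,1)] assms
  by (simp add: star_comm orth_closed)

end

section \<open>The bimonoid of facts of a phase space\<close>

text \<open>The record is characterised by equations, and its operations only on facts, because the
  operations of \<open>galois_bimonoid\<close> are built from polars, whose translation into
  orthogonals is available for subsets of the carrier.\<close>

locale phase_bimonoid = phase_space M pole
  for M :: "('a, 'b) monoid_scheme" (structure) and pole +
  fixes G :: "('a set, 'm) bimonoid_scheme"
  assumes carrier_G: "carrier G = {X. fact X}"
    and eq_G: "eq G = (=)"
    and le_G: "le G = (\<subseteq>)"
    and mul_G: "\<lbrakk>fact X; fact Y\<rbrakk> \<Longrightarrow> X \<odot>\<^bsub>G\<^esub> Y = orth (orth (X \<star> Y))"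
    and one_G: "bone G = orth (orth {\<one>})"
    and plus_G: "\<lbrakk>fact X; fact Y\<rbrakk> \<Longrightarrow> X \<oplus>\<^bsub>G\<^esub> Y = orth (orth X \<star> orth Y)"
    and zero_G: "bzero G = orth {\<one>}"
begin

section \<open>Bimonoid laws for facts\<close>

lemma fact_one: "fact (bone G)"
  by (simp add: one_G fact_orth_orth)

lemma fact_zero: "fact (bzero G)"
  by (simp add: zero_G fact_orth)

lemma fact_mul: "\<lbrakk>fact X; fact Y\<rbrakk> \<Longrightarrow> fact (X \<odot>\<^bsub>G\<^esub> Y)"
  by (simp add: mul_G fact_orth_orth)

lemma fact_plus: "\<lbrakk>fact X; fact Y\<rbrakk> \<Longrightarrow> fact (X \<oplus>\<^bsub>G\<^esub> Y)"
  by (simp add: plus_G fact_orth star_closed orth_closed)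

lemma mul_subset_iff:
  assumes "fact X" "fact Y" "fact Z"
  shows "X \<odot>\<^bsub>G\<^esub> Y \<subseteq> Z \<longleftrightarrow> X \<star> Y \<subseteq> Z"
  using assms by (simp add: mul_G orth_orth_subset_iff star_closed fact_closed)

text \<open>Residuation for the sum: since \<open>Y\<close> is the orthogonal of
  \<open>orth Y\<close>, the fact \<open>X \<oplus> Y\<close> acts as the linear implication from
  \<open>orth X\<close> to \<open>Y\<close>.\<close>

lemma subset_plus_iff:
  assumes "W \<subseteq> carrier M" "fact X" "fact Y"
  shows "W \<subseteq> X \<oplus>\<^bsub>G\<^esub> Y \<longleftrightarrow> W \<star> orth X \<subseteq> Y"
  using assms star_subset_orth_iff[of W "orth X" "orth Y"]
  by (simp add: plus_G orth_closed orth_orth_fact)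

lemma mul_comm_G: "\<lbrakk>fact X; fact Y\<rbrakk> \<Longrightarrow> X \<odot>\<^bsub>G\<^esub> Y = Y \<odot>\<^bsub>G\<^esub> X"
  by (metis fact_closed mul_G star_comm)

lemma plus_comm_G: "\<lbrakk>fact X; fact Y\<rbrakk> \<Longrightarrow> X \<oplus>\<^bsub>G\<^esub> Y = Y \<oplus>\<^bsub>G\<^esub> X"
  by (metis orth_closed plus_G star_comm)

lemma orth_mul: "\<lbrakk>fact X; fact Y\<rbrakk> \<Longrightarrow> orth (X \<odot>\<^bsub>G\<^esub> Y) = orth (X \<star> Y)"
  by (simp add: mul_G orth_orth_orth star_closed fact_closed)

text \<open>De Morgan duality, through which the monoid laws of the sum are inherited from those of
  the product.\<close>

lemma orth_plus: "\<lbrakk>fact X; fact Y\<rbrakk> \<Longrightarrow> orth (X \<oplus>\<^bsub>G\<^esub> Y) = orth X \<odot>\<^bsub>G\<^esub> orth Y"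
  by (simp add: mul_G plus_G fact_orth fact_closed)

lemma plus_eq_orth_mul: "\<lbrakk>fact X; fact Y\<rbrakk> \<Longrightarrow> X \<oplus>\<^bsub>G\<^esub> Y = orth (orth X \<odot>\<^bsub>G\<^esub> orth Y)"
  by (metis fact_plus orth_orth_fact orth_plus)

lemma mul_assoc_G:
  assumes "fact X" "fact Y" "fact Z"
  shows "X \<odot>\<^bsub>G\<^esub> Y \<odot>\<^bsub>G\<^esub> Z = X \<odot>\<^bsub>G\<^esub> (Y \<odot>\<^bsub>G\<^esub> Z)"
  using assms
  by (simp add: mul_G fact_orth_orth orth_star_orth_orth_left orth_star_orth_orth_right
      star_closed fact_closed star_assoc)

lemma one_mul_G: "fact X \<Longrightarrow> bone G \<odot>\<^bsub>G\<^esub> X = X"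
  by (simp add: mul_G one_G fact_orth_orth orth_star_orth_orth_left one_star fact_closed orth_orth_fact)

lemma orth_zero: "orth (bzero G) = bone G"
  by (simp add: one_G zero_G)

lemma plus_assoc_G:
  assumes "fact X" "fact Y" "fact Z"
  shows "X \<oplus>\<^bsub>G\<^esub> Y \<oplus>\<^bsub>G\<^esub> Z = X \<oplus>\<^bsub>G\<^esub> (Y \<oplus>\<^bsub>G\<^esub> Z)"
  using assms
  by (simp add: plus_eq_orth_mul[of "X \<oplus>\<^bsub>G\<^esub> Y"] plus_eq_orth_mul[of X "Y \<oplus>\<^bsub>G\<^esub> Z"]
      fact_plus orth_plus mul_assoc_G fact_orth fact_closed)

lemma zero_plus_G: "fact X \<Longrightarrow> bzero G \<oplus>\<^bsub>G\<^esub> X = X"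
  by (simp add: plus_eq_orth_mul fact_zero orth_zero one_mul_G fact_orth fact_closed orth_orth_fact)

lemma mul_mono_G: "\<lbrakk>fact X; fact Y; fact Z; X \<subseteq> Y\<rbrakk> \<Longrightarrow> X \<odot>\<^bsub>G\<^esub> Z \<subseteq> Y \<odot>\<^bsub>G\<^esub> Z"
  by (simp add: mul_G orth_antimono star_mono)

lemma plus_mono_G: "\<lbrakk>fact X; fact Y; fact Z; X \<subseteq> Y\<rbrakk> \<Longrightarrow> X \<oplus>\<^bsub>G\<^esub> Z \<subseteq> Y \<oplus>\<^bsub>G\<^esub> Z"
  by (simp add: plus_G orth_antimono star_mono)

text \<open>Read as an implication, \<open>Y \<oplus> Z\<close> carries \<open>orth Z\<close> into
  \<open>Y\<close>. Multiplying by \<open>X\<close> carries \<open>orth Z\<close> into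
  \<open>X \<odot> Y\<close>, and residuation turns this back into a sum.\<close>

lemma hemidistrib_G:
  assumes X: "fact X" and Y: "fact Y" and Z: "fact Z"
  shows "X \<odot>\<^bsub>G\<^esub> (Y \<oplus>\<^bsub>G\<^esub> Z) \<subseteq> (X \<odot>\<^bsub>G\<^esub> Y) \<oplus>\<^bsub>G\<^esub> Z"
proof -
  let ?S = "Y \<oplus>\<^bsub>G\<^esub> Z"
  note closed = fact_closed[OF X] fact_closed[OF Y] fact_closed[OF fact_plus[OF Y Z]] orth_closed
  have "?S \<star> orth Z \<subseteq> Y"
    using subset_plus_iff[of ?S Z Y] closed Y Z by (simp add: plus_comm_G)
  then have "X \<star> ?S \<star> orth Z \<subseteq> X \<star> Y"
    using closed by (simp add: star_assoc star_mono)
  also have "\<dots> \<subseteq> X \<odot>\<^bsub>G\<^esub> Y"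
    using X Y closed by (simp add: mul_G subset_orth_orth star_closed)
  finally have "X \<star> ?S \<subseteq> Z \<oplus>\<^bsub>G\<^esub> (X \<odot>\<^bsub>G\<^esub> Y)"
    using X Y Z closed by (simp add: subset_plus_iff star_closed fact_mul)
  then show ?thesis
    using X Y Z by (simp add: mul_subset_iff fact_mul fact_plus plus_comm_G)
qed

lemma partial_order_G: "partial_order G"
  by unfold_locales (auto simp: le_G eq_G)

lemma comm_bimonoid_G: "comm_bimonoid G"
proof (intro comm_bimonoid.intro comm_bimonoid_axioms.intro bimonoid.intro bimonoid_axioms.intro
    partial_order_G)
  show "monoid (mul_monoid G)"
    by (rule monoidI)
      (auto simp: mul_monoid_def carrier_G fact_mul fact_one mul_assoc_G one_mul_G,
        metis fact_one mul_comm_G one_mul_G, metis fact_one mul_comm_G one_mul_G)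
  show "monoid (plus_monoid G)"
    by (rule monoidI)
      (auto simp: plus_monoid_def carrier_G fact_plus fact_zero plus_assoc_G zero_plus_G,
        metis fact_zero plus_comm_G zero_plus_G, metis fact_zero plus_comm_G zero_plus_G)
next
  fix x y z
  assume xyz: "x \<in> carrier G" "y \<in> carrier G" "z \<in> carrier G"
  then have facts: "fact x" "fact y" "fact z"
    by (simp_all add: carrier_G)
  show "x \<odot>\<^bsub>G\<^esub> (y \<oplus>\<^bsub>G\<^esub> z) \<sqsubseteq>\<^bsub>G\<^esub> (x \<odot>\<^bsub>G\<^esub> y) \<oplus>\<^bsub>G\<^esub> z"
    using facts by (simp add: le_G hemidistrib_G)
  then show "(z \<oplus>\<^bsub>G\<^esub> y) \<odot>\<^bsub>G\<^esub> x \<sqsubseteq>\<^bsub>G\<^esub> z \<oplus>\<^bsub>G\<^esub> (y \<odot>\<^bsub>G\<^esub> x)"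
    using facts by (simp add: mul_comm_G plus_comm_G fact_mul fact_plus)
  assume "x \<sqsubseteq>\<^bsub>G\<^esub> y"
  then show "x \<odot>\<^bsub>G\<^esub> z \<sqsubseteq>\<^bsub>G\<^esub> y \<odot>\<^bsub>G\<^esub> z" "x \<oplus>\<^bsub>G\<^esub> z \<sqsubseteq>\<^bsub>G\<^esub> y \<oplus>\<^bsub>G\<^esub> z"
    using facts by (simp_all add: le_G mul_mono_G plus_mono_G)
  then show "z \<odot>\<^bsub>G\<^esub> x \<sqsubseteq>\<^bsub>G\<^esub> z \<odot>\<^bsub>G\<^esub> y" "z \<oplus>\<^bsub>G\<^esub> x \<sqsubseteq>\<^bsub>G\<^esub> z \<oplus>\<^bsub>G\<^esub> y"
    using facts by (simp_all add: mul_comm_G plus_comm_G)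
qed (simp_all add: carrier_G mul_comm_G plus_comm_G)

section \<open>The complete lattice of facts and distributivity\<close>

lemma is_lub_G:
  assumes "\<X> \<subseteq> carrier G"
  shows "least G (orth (orth (\<Union>\<X>))) (Upper G \<X>)"
proof -
  have sub: "\<Union>\<X> \<subseteq> carrier M"
    using assms by (auto simp: carrier_G fact_def)
  have "\<Union>\<X> \<subseteq> orth (orth (\<Union>\<X>))"
    by (rule subset_orth_orth[OF sub])
  moreover have "orth (orth (\<Union>\<X>)) \<subseteq> Y" if "fact Y" "\<And>X. X \<in> \<X> \<Longrightarrow> X \<subseteq> Y" for Y
    using that sub by (simp add: orth_orth_subset_iff Union_least)
  ultimately show ?thesis
    using assms by (fastforce simp: least_def Upper_def le_G carrier_G fact_orth_orth)
qed

text \<open>An intersection of facts is a fact because its closure lies in each member. Intersecting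
  with \<open>carrier M\<close> makes the empty family yield the top element.\<close>

lemma is_glb_G:
  assumes "\<X> \<subseteq> carrier G"
  shows "greatest G (carrier M \<inter> \<Inter>\<X>) (Lower G \<X>)"
proof -
  let ?I = "carrier M \<inter> \<Inter>\<X>"
  have "orth (orth ?I) \<subseteq> X" if "X \<in> \<X>" for X
    using assms that orth_orth_subset_iff[of ?I X] by (auto simp: carrier_G)
  then have "fact ?I"
    unfolding fact_def using orth_closed[of "orth ?I"] subset_orth_orth[of ?I] by blast
  then show ?thesis
    using assms by (fastforce simp: greatest_def Lower_def le_G carrier_G dest: fact_closed)
qed

lemma complete_lattice_G: "complete_lattice G"
proof -
  interpret partial_order G by (rule partial_order_G)
  show ?thesis
    by (rule complete_latticeI) (blast intro: is_lub_G is_glb_G)+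
qed

lemma lattice_G: "lattice G"
  by (simp add: complete_lattice_G)

text \<open>The join in the record is specified only as a least upper bound, so uniqueness
  identifies it with the closure of the union.\<close>

lemma join_G:
  assumes "fact X" "fact Y"
  shows "X \<squnion>\<^bsub>G\<^esub> Y = orth (orth (X \<union> Y))"
proof -
  interpret lattice G by (rule lattice_G)
  have "least G (X \<squnion>\<^bsub>G\<^esub> Y) (Upper G {X, Y})"
    using assms by (simp add: join_def sup_of_two_least carrier_G)
  moreover have "least G (orth (orth (X \<union> Y))) (Upper G {X, Y})"
    using is_lub_G[of "{X, Y}"] assms by (simp add: carrier_G)
  ultimately show ?thesis
    by (rule least_unique)
qed

lemma meet_G:
  assumes "fact X" "fact Y"
  shows "X \<sqinter>\<^bsub>G\<^esub> Y = X \<inter> Y"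
proof -
  interpret lattice G by (rule lattice_G)
  have "greatest G (X \<sqinter>\<^bsub>G\<^esub> Y) (Lower G {X, Y})"
    using assms by (simp add: meet_def inf_of_two_greatest carrier_G)
  moreover have "greatest G (X \<inter> Y) (Lower G {X, Y})"
    using is_glb_G[of "{X, Y}"] assms fact_closed[of X]
    by (simp add: carrier_G Int_absorb1 le_infI1)
  ultimately show ?thesis
    by (rule greatest_unique)
qed

lemma fact_Int:
  assumes "fact X" "fact Y"
  shows "fact (X \<inter> Y)"
proof -
  interpret lattice G by (rule lattice_G)
  show ?thesis
    using meet_closed[of X Y] assms by (simp add: carrier_G meet_G)
qed

text \<open>On plain sets \<open>\<star>\<close> distributes over unions, and the closures
  introduced by join and product disappear under an outer \<open>orth\<close>.\<close>

lemma mul_join_distrib_G: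
  assumes "fact X" "fact Y" "fact Z"
  shows "X \<odot>\<^bsub>G\<^esub> (Y \<squnion>\<^bsub>G\<^esub> Z) = (X \<odot>\<^bsub>G\<^esub> Y) \<squnion>\<^bsub>G\<^esub> (X \<odot>\<^bsub>G\<^esub> Z)"
proof -
  have "X \<star> (Y \<union> Z) = X \<star> Y \<union> X \<star> Z"
    unfolding star_def by blast
  then have "X \<odot>\<^bsub>G\<^esub> (Y \<squnion>\<^bsub>G\<^esub> Z) = orth (orth (X \<star> Y \<union> X \<star> Z))"
    using assms by (simp add: join_G mul_G fact_orth_orth orth_star_orth_orth_right fact_closed)
  also have "\<dots> = (X \<odot>\<^bsub>G\<^esub> Y) \<squnion>\<^bsub>G\<^esub> (X \<odot>\<^bsub>G\<^esub> Z)"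
    using assms by (simp add: join_G fact_mul orth_Un orth_mul)
  finally show ?thesis .
qed

lemma plus_meet_distrib_G:
  assumes "fact X" "fact Y" "fact Z"
  shows "X \<oplus>\<^bsub>G\<^esub> (Y \<sqinter>\<^bsub>G\<^esub> Z) = (X \<oplus>\<^bsub>G\<^esub> Y) \<sqinter>\<^bsub>G\<^esub> (X \<oplus>\<^bsub>G\<^esub> Z)"
proof -
  \<comment> \<open>Through \<open>subset_plus_iff\<close> the left side becomes
    \<open>W \<star> orth X \<subseteq> Y \<inter> Z\<close>, which splits into the conditions for
    \<open>Y\<close> and for \<open>Z\<close>.\<close>
  have "W \<subseteq> X \<oplus>\<^bsub>G\<^esub> (Y \<inter> Z) \<longleftrightarrow> W \<subseteq> (X \<oplus>\<^bsub>G\<^esub> Y) \<inter> (X \<oplus>\<^bsub>G\<^esub> Z)" if "W \<subseteq> carrier M" for W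
    using assms that by (simp add: subset_plus_iff fact_Int)
  then have "X \<oplus>\<^bsub>G\<^esub> (Y \<inter> Z) = (X \<oplus>\<^bsub>G\<^esub> Y) \<inter> (X \<oplus>\<^bsub>G\<^esub> Z)"
    using assms by (meson fact_Int fact_closed fact_plus order_refl subset_antisym)
  then show ?thesis
    using assms by (simp add: meet_G fact_plus)
qed

lemma comm_lbimonoid_G: "comm_lbimonoid G"
proof -
  interpret comm_bimonoid G by (rule comm_bimonoid_G)
  interpret lattice G by (rule lattice_G)
  show ?thesis
    by unfold_locales (simp_all add: carrier_G mul_join_distrib_G plus_meet_distrib_G)
qed

section \<open>Complements and dense families of facts\<close>

lemma is_complement_G_iff:
  assumes X: "fact X"
  shows "is_complement G X Y \<longleftrightarrow> Y = orth X"
proof -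
  \<comment> \<open>Residuation turns the two inequalities defining a complement into the two
    inclusions of \<open>Y = orth X\<close>, so existence and uniqueness are obtained
    together.\<close>
  have "X \<odot>\<^bsub>G\<^esub> Y \<subseteq> bzero G \<and> bone G \<subseteq> X \<oplus>\<^bsub>G\<^esub> Y \<longleftrightarrow> Y = orth X" if Y: "fact Y"
  proof -
    note closed = fact_closed[OF X] fact_closed[OF Y] orth_closed
    have "X \<odot>\<^bsub>G\<^esub> Y \<subseteq> bzero G \<longleftrightarrow> Y \<star> X \<subseteq> orth {\<one>}"
      using X Y by (simp add: mul_subset_iff zero_G fact_orth star_comm fact_closed)
    also have "\<dots> \<longleftrightarrow> Y \<subseteq> orth X"
      using closed by (simp add: star_subset_orth_iff star_comm[of X] one_star)
    finally have 1: "X \<odot>\<^bsub>G\<^esub> Y \<subseteq> bzero G \<longleftrightarrow> Y \<subseteq> orth X" .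
    have "bone G \<subseteq> X \<oplus>\<^bsub>G\<^esub> Y \<longleftrightarrow> bone G \<odot>\<^bsub>G\<^esub> orth X \<subseteq> Y"
      using X Y by (simp add: subset_plus_iff mul_subset_iff fact_one fact_orth fact_closed)
    then have 2: "bone G \<subseteq> X \<oplus>\<^bsub>G\<^esub> Y \<longleftrightarrow> orth X \<subseteq> Y"
      using X by (simp add: one_mul_G fact_orth fact_closed)
    from 1 2 show ?thesis by blast
  qed
  then show ?thesis
    using X by (auto simp: is_complement_def carrier_G le_G fact_orth fact_closed)
qed

lemma complement_G: "fact X \<Longrightarrow> complement G X = orth X"
  by (simp add: complement_def is_complement_G_iff)

lemma complemented_G: "complemented G"
  by (simp add: complemented_def carrier_G is_complement_G_iff)

lemma join_dense_G: "join_dense G {orth (orth {p}) | p. p \<in> carrier M}"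
  unfolding join_dense_def
proof (intro conjI ballI)
  fix X assume "X \<in> carrier G"
  then have X: "fact X" by (simp add: carrier_G)
  let ?T = "{orth (orth {p}) | p. p \<in> X}"
  have "orth (orth {p}) \<subseteq> X" "p \<in> orth (orth {p})" if "p \<in> X" for p
    using that X fact_closed[OF X] orth_orth_subset_iff[of "{p}" X] subset_orth_orth[of "{p}"]
    by auto
  \<comment> \<open>A fact contains the closure of each of its points, so it is already the plain
    union of these closures.\<close>
  then have "\<Union>?T = X" by blast
  moreover have "?T \<subseteq> carrier G"
    by (auto simp: carrier_G fact_orth_orth)
  ultimately have "least G X (Upper G ?T)"
    using is_lub_G[of ?T] orth_orth_fact[OF X] by simp
  then show "\<exists>T\<subseteq>{orth (orth {p}) | p. p \<in> carrier M}. least G X (Upper G T)"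
    using fact_closed[OF X] by (intro exI[of _ ?T]) auto
qed (auto simp: carrier_G fact_orth_orth)

lemma meet_dense_G: "meet_dense G {orth {p} | p. p \<in> carrier M}"
  unfolding meet_dense_def
proof (intro conjI ballI)
  fix X assume "X \<in> carrier G"
  then have X: "fact X" by (simp add: carrier_G)
  let ?T = "{orth {p} | p. p \<in> orth X}"
  \<comment> \<open>Being orthogonal to a set means being orthogonal to each of its points; the
    points used here are those of \<open>orth X\<close>, whose orthogonal is \<open>X\<close>
    again.\<close>
  have "carrier M \<inter> \<Inter>?T = orth (orth X)"
    by (auto simp: orth_def)
  moreover have "?T \<subseteq> carrier G"
    using orth_closed[of X] by (auto simp: carrier_G intro!: fact_orth)
  ultimately have "greatest G X (Lower G ?T)"
    using is_glb_G[of ?T] orth_orth_fact[OF X] by simp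
  then show "\<exists>T\<subseteq>{orth {p} | p. p \<in> carrier M}. greatest G X (Lower G T)"
    using orth_closed[of X] by (intro exI[of _ ?T]) auto
qed (auto simp: carrier_G fact_orth)

end

section \<open>The Galois-closed sets as facts\<close>

text \<open>Second components are added because the product of the complements of \<open>b\<close>
  and \<open>d\<close> is the complement of \<open>b \<oplus> d\<close>.\<close>

definition pair_monoid :: "('a, 'm) bimonoid_scheme \<Rightarrow> ('a \<times> 'a) monoid" where
  "pair_monoid A = \<lparr>carrier = carrier A \<times> carrier A,
     mult = (\<lambda>p q. (fst p \<odot>\<^bsub>A\<^esub> fst q, snd p \<oplus>\<^bsub>A\<^esub> snd q)), one = (bone A, bzero A)\<rparr>"

text \<open>In a complemented commutative bimonoid, \<open>a\<close> times the complement of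
  \<open>b\<close> lies below zero exactly when \<open>a \<sqsubseteq> b\<close>; the pole thus
  collects the formal products below zero.\<close>

definition pair_pole :: "('a, 'm) bimonoid_scheme \<Rightarrow> ('a \<times> 'a) set" where
  "pair_pole A = {(a, b). a \<sqsubseteq>\<^bsub>A\<^esub> b}"

section \<open>Monoid laws in record-free form\<close>

context bimonoid
begin

lemma mul_closed: "\<lbrakk>x \<in> carrier B; y \<in> carrier B\<rbrakk> \<Longrightarrow> x \<odot> y \<in> carrier B"
  and mul_assoc: "\<lbrakk>x \<in> carrier B; y \<in> carrier B; z \<in> carrier B\<rbrakk> \<Longrightarrow> x \<odot> y \<odot> z = x \<odot> (y \<odot> z)"
  and bone_closed: "bone B \<in> carrier B"
  and one_mul: "x \<in> carrier B \<Longrightarrow> bone B \<odot> x = x"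
  and mul_one: "x \<in> carrier B \<Longrightarrow> x \<odot> bone B = x"
  using monoid.m_closed[OF mul_monoid] monoid.m_assoc[OF mul_monoid] monoid.one_closed[OF mul_monoid]
    monoid.l_one[OF mul_monoid] monoid.r_one[OF mul_monoid]
  by (simp_all add: mul_monoid_def)

lemma plus_closed: "\<lbrakk>x \<in> carrier B; y \<in> carrier B\<rbrakk> \<Longrightarrow> x \<oplus> y \<in> carrier B"
  and plus_assoc: "\<lbrakk>x \<in> carrier B; y \<in> carrier B; z \<in> carrier B\<rbrakk> \<Longrightarrow> x \<oplus> y \<oplus> z = x \<oplus> (y \<oplus> z)"
  and bzero_closed: "bzero B \<in> carrier B"
  and zero_plus: "x \<in> carrier B \<Longrightarrow> bzero B \<oplus> x = x"
  and plus_zero: "x \<in> carrier B \<Longrightarrow> x \<oplus> bzero B = x"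
  using monoid.m_closed[OF plus_monoid] monoid.m_assoc[OF plus_monoid]
    monoid.one_closed[OF plus_monoid] monoid.l_one[OF plus_monoid] monoid.r_one[OF plus_monoid]
  by (simp_all add: plus_monoid_def)

lemmas bimonoid_simps = mul_closed bone_closed one_mul mul_one
  plus_closed bzero_closed zero_plus plus_zero

end

section \<open>Polars as orthogonals in the monoid of pairs\<close>

context comm_bimonoid
begin

lemma comm_monoid_pair_monoid: "comm_monoid (pair_monoid B)"
  by (rule comm_monoidI)
    (auto simp: pair_monoid_def bimonoid_simps mul_assoc plus_assoc intro: mul_comm plus_comm)

sublocale pairs: phase_space "pair_monoid B" "pair_pole B"
  by (rule phase_space.intro[OF comm_monoid_pair_monoid])

lemma carrier_pair_monoid: "carrier (pair_monoid B) = carrier B \<times> carrier B"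
  and mult_pair_monoid: "(a, b) \<otimes>\<^bsub>pair_monoid B\<^esub> (c, d) = (a \<odot> c, b \<oplus> d)"
  and one_pair_monoid: "\<one>\<^bsub>pair_monoid B\<^esub> = (bone B, bzero B)"
  by (simp_all add: pair_monoid_def)

lemma mem_orth_pairs_iff:
  "(a, b) \<in> pairs.orth X \<longleftrightarrow>
     a \<in> carrier B \<and> b \<in> carrier B \<and> (\<forall>(c, d)\<in>X. a \<odot> c \<sqsubseteq> b \<oplus> d)"
  unfolding pairs.orth_def by (auto simp: pair_monoid_def pair_pole_def)

text \<open>The polar relation between \<open>(a, b)\<close> and \<open>(c, d)\<close> is
  orthogonality of \<open>(a, b)\<close> and \<open>(d, c)\<close>; the relational converse performs
  this swap.\<close>

lemma lpolar_eq_orth: "lpolar B Y = pairs.orth (Y\<inverse>)"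
  by (fastforce simp: lpolar_def mem_orth_pairs_iff)

lemma rpolar_eq_orth:
  assumes "X \<subseteq> carrier B \<times> carrier B"
  shows "rpolar B X = (pairs.orth X)\<inverse>"
proof -
  have "a \<odot> d \<sqsubseteq> b \<oplus> c \<longleftrightarrow> d \<odot> a \<sqsubseteq> c \<oplus> b"
    if "(a, b) \<in> X" "c \<in> carrier B" "d \<in> carrier B" for a b c d
    using assms that by (auto simp: mul_comm[of a d] plus_comm[of b c])
  then show ?thesis
    by (fastforce simp: rpolar_def mem_orth_pairs_iff)
qed

text \<open>The swaps from the left and the right polar cancel.\<close>

lemma gclosure_eq_orth:
  "X \<subseteq> carrier B \<times> carrier B \<Longrightarrow> gclosure B X = pairs.orth (pairs.orth X)"
  by (simp add: gclosure_def lpolar_eq_orth rpolar_eq_orth)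

lemma galois_compl_eq_orth: "galois_compl B X = pairs.orth X"
proof -
  have "{(b, a) | a b. (a, b) \<in> X} = X\<inverse>" by auto
  then show ?thesis by (simp add: galois_compl_def lpolar_eq_orth)
qed

lemma galois_embedding_eq_orth: "galois_embedding B a = pairs.orth {(bone B, a)}"
proof -
  have "{(a, bone B)}\<inverse> = {(bone B, a)}" by auto
  then show ?thesis by (simp add: galois_embedding_def lpolar_eq_orth)
qed

lemma star_pairs:
  "pairs.star X Y = {(a \<odot> c, b \<oplus> d) | a b c d. (a, b) \<in> X \<and> (c, d) \<in> Y}"
  by (simp add: pairs.star_def mult_pair_monoid)

lemma phase_bimonoid_galois_bimonoid:
  "phase_bimonoid (pair_monoid B) (pair_pole B) (galois_bimonoid B)"
proof
  show "carrier (galois_bimonoid B) = {X. pairs.fact X}"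
    by (auto simp: galois_bimonoid_def pairs.fact_def carrier_pair_monoid gclosure_eq_orth)
next
  fix X Y assume XY: "pairs.fact X" "pairs.fact Y"
  note closed = pairs.fact_closed[OF XY(1)] pairs.fact_closed[OF XY(2)]
  show "X \<odot>\<^bsub>galois_bimonoid B\<^esub> Y = pairs.orth (pairs.orth (pairs.star X Y))"
    using pairs.star_closed[OF closed]
    by (simp add: galois_bimonoid_def gclosure_eq_orth carrier_pair_monoid flip: star_pairs)
  \<comment> \<open>Right polars are swapped orthogonals, so adding first and multiplying second
    components is the product of pairs up to converse.\<close>
  have "{(c \<oplus> c', d \<odot> d') | c d c' d'. (c, d) \<in> rpolar B X \<and> (c', d') \<in> rpolar B Y}
      = (pairs.star (pairs.orth X) (pairs.orth Y))\<inverse>"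
    using closed by (auto simp: star_pairs rpolar_eq_orth carrier_pair_monoid; blast)
  then show "X \<oplus>\<^bsub>galois_bimonoid B\<^esub> Y = pairs.orth (pairs.star (pairs.orth X) (pairs.orth Y))"
    by (simp add: galois_bimonoid_def lpolar_eq_orth)
next
  have "{(bzero B, bone B)}\<inverse> = {(bone B, bzero B)}" by auto
  then show "bzero (galois_bimonoid B) = pairs.orth {\<one>\<^bsub>pair_monoid B\<^esub>}"
    by (simp add: galois_bimonoid_def lpolar_eq_orth one_pair_monoid)
qed (simp_all add: galois_bimonoid_def gclosure_eq_orth one_pair_monoid bone_closed bzero_closed)

sublocale galois: phase_bimonoid "pair_monoid B" "pair_pole B" "galois_bimonoid B"
  by (rule phase_bimonoid_galois_bimonoid)

section \<open>The embedding and its two descriptions\<close>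

lemma mem_galois_embedding_iff:
  assumes "a \<in> carrier B"
  shows "(c, d) \<in> galois_embedding B a \<longleftrightarrow> c \<in> carrier B \<and> d \<in> carrier B \<and> c \<sqsubseteq> d \<oplus> a"
  using assms by (auto simp: galois_embedding_eq_orth mem_orth_pairs_iff bimonoid_simps)

text \<open>The point \<open>(a, bzero B)\<close> lies in the image of \<open>a\<close>, which gives
  one inclusion. Conversely, if \<open>x \<odot> a \<sqsubseteq> y\<close> and
  \<open>c \<sqsubseteq> d \<oplus> a\<close>, hemidistributivity yields \<open>x \<odot> c
  \<sqsubseteq> (x \<odot> a) \<oplus> d \<sqsubseteq> y \<oplus> d\<close>.\<close>

lemma orth_galois_embedding:
  assumes a: "a \<in> carrier B"
  shows "pairs.orth (galois_embedding B a) = pairs.orth {(a, bzero B)}"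
proof (intro equalityI subrelI)
  fix x y assume xy: "(x, y) \<in> pairs.orth (galois_embedding B a)"
  have "(a, bzero B) \<in> galois_embedding B a"
    using a by (simp add: mem_galois_embedding_iff bimonoid_simps)
  with xy show "(x, y) \<in> pairs.orth {(a, bzero B)}"
    by (auto simp: mem_orth_pairs_iff)
next
  fix x y assume "(x, y) \<in> pairs.orth {(a, bzero B)}"
  then have xy: "x \<in> carrier B" "y \<in> carrier B" "x \<odot> a \<sqsubseteq> y"
    by (auto simp: mem_orth_pairs_iff bimonoid_simps)
  have "x \<odot> c \<sqsubseteq> y \<oplus> d" if c: "c \<in> carrier B" and d: "d \<in> carrier B" and cd: "c \<sqsubseteq> d \<oplus> a" for c d
  proof -
    have "x \<odot> c \<sqsubseteq> x \<odot> (a \<oplus> d)"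
      using xy a c d cd by (simp add: mul_mono_right bimonoid_simps plus_comm)
    also have "\<dots> \<sqsubseteq> (x \<odot> a) \<oplus> d"
      using xy a d by (simp add: hemidistrib_left)
    also have "\<dots> \<sqsubseteq> y \<oplus> d"
      using xy a d by (simp add: plus_mono_left bimonoid_simps)
    finally show ?thesis
      using xy a c d by (simp add: bimonoid_simps)
  qed
  then show "(x, y) \<in> pairs.orth (galois_embedding B a)"
    using xy a by (auto simp: mem_orth_pairs_iff mem_galois_embedding_iff)
qed

lemma fact_galois_embedding: "a \<in> carrier B \<Longrightarrow> pairs.fact (galois_embedding B a)"
  by (simp add: galois_embedding_eq_orth pairs.fact_orth carrier_pair_monoid bone_closed)

lemma galois_embedding_eq_orth_orth:
  "a \<in> carrier B \<Longrightarrow> galois_embedding B a = pairs.orth (pairs.orth {(a, bzero B)})"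
  by (metis fact_galois_embedding orth_galois_embedding pairs.orth_orth_fact)

text \<open>Computations with closures of single points reduce to one multiplication in the monoid
  of pairs.\<close>

lemma orth_star_closures:
  assumes "a \<in> carrier B" "b \<in> carrier B" "c \<in> carrier B" "d \<in> carrier B"
  shows "pairs.orth (pairs.star (pairs.orth (pairs.orth {(a, b)})) (pairs.orth (pairs.orth {(c, d)})))
    = pairs.orth {(a \<odot> c, b \<oplus> d)}"
proof -
  have "{(a, b)} \<subseteq> carrier (pair_monoid B)" "{(c, d)} \<subseteq> carrier (pair_monoid B)"
    using assms by (simp_all add: carrier_pair_monoid)
  then show ?thesis
    by (simp only: pairs.orth_star_orth_orth_left pairs.orth_star_orth_orth_right pairs.orth_closed
        pairs.star_singletons mult_pair_monoid)
qed

text \<open>The images are closures of \<open>(a, bzero B)\<close> and \<open>(b, bzero B)\<close>,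
  whose product is \<open>(a \<odot> b, bzero B)\<close>.\<close>

lemma galois_embedding_mul:
  assumes "a \<in> carrier B" "b \<in> carrier B"
  shows "galois_embedding B (a \<odot> b) = galois_embedding B a \<odot>\<^bsub>galois_bimonoid B\<^esub> galois_embedding B b"
  using assms
  by (simp add: galois.mul_G fact_galois_embedding)
     (simp add: galois_embedding_eq_orth_orth orth_star_closures bimonoid_simps)

text \<open>Dually, the orthogonals of the images are closures of \<open>(bone B, a)\<close> and
  \<open>(bone B, b)\<close>, whose product is \<open>(bone B, a \<oplus> b)\<close>.\<close>

lemma galois_embedding_plus:
  assumes "a \<in> carrier B" "b \<in> carrier B"
  shows "galois_embedding B (a \<oplus> b) = galois_embedding B a \<oplus>\<^bsub>galois_bimonoid B\<^esub> galois_embedding B b"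
  using assms
  by (simp add: galois.plus_G fact_galois_embedding)
     (simp add: galois_embedding_eq_orth orth_star_closures bimonoid_simps)

text \<open>The generators \<open>(a, bzero B)\<close> and \<open>(bone B, b)\<close> multiply to
  \<open>(a, b)\<close>, which justifies reading pairs as formal products.\<close>

lemma galois_embedding_mul_complement:
  assumes "a \<in> carrier B" "b \<in> carrier B"
  shows "galois_embedding B a \<odot>\<^bsub>galois_bimonoid B\<^esub>
      complement (galois_bimonoid B) (galois_embedding B b) = pairs.orth (pairs.orth {(a, b)})"
proof -
  have "complement (galois_bimonoid B) (galois_embedding B b) = pairs.orth (pairs.orth {(bone B, b)})"
    using galois.complement_G[OF fact_galois_embedding[OF assms(2)]]
    by (simp add: galois_embedding_eq_orth)
  then show ?thesis
    using assms
    by (simp add: galois.mul_G pairs.fact_orth_orth galois_embedding_eq_orth_orth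
        orth_star_closures bimonoid_simps)
qed

text \<open>The orthogonals of the two summands are closures of \<open>(bone B, a)\<close> and
  \<open>(b, bzero B)\<close>; multiplying these generators gives \<open>(b, a)\<close>, hence the
  swapped pair.\<close>

lemma galois_embedding_plus_complement:
  assumes "a \<in> carrier B" "b \<in> carrier B"
  shows "galois_embedding B a \<oplus>\<^bsub>galois_bimonoid B\<^esub>
      complement (galois_bimonoid B) (galois_embedding B b) = pairs.orth {(b, a)}"
proof -
  have "complement (galois_bimonoid B) (galois_embedding B b) = pairs.orth {(b, bzero B)}"
    using galois.complement_G[OF fact_galois_embedding[OF assms(2)]] assms
    by (simp add: orth_galois_embedding)
  moreover have "pairs.fact (pairs.orth {(b, bzero B)})"
    using assms by (simp add: pairs.fact_orth carrier_pair_monoid bzero_closed)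
  ultimately have "galois_embedding B a \<oplus>\<^bsub>galois_bimonoid B\<^esub>
      complement (galois_bimonoid B) (galois_embedding B b)
    = pairs.orth (pairs.star (pairs.orth (galois_embedding B a)) (pairs.orth (pairs.orth {(b, bzero B)})))"
    using assms by (simp add: galois.plus_G fact_galois_embedding)
  then show ?thesis
    using assms by (simp add: galois_embedding_eq_orth orth_star_closures bimonoid_simps)
qed

lemma galois_embedding_le_iff:
  assumes "a \<in> carrier B" "b \<in> carrier B"
  shows "galois_embedding B a \<subseteq> galois_embedding B b \<longleftrightarrow> a \<sqsubseteq> b"
proof
  assume "galois_embedding B a \<subseteq> galois_embedding B b"
  \<comment> \<open>The generator \<open>(a, bzero B)\<close> is the test point: it lies in the
    image of \<open>b\<close> exactly when \<open>a \<sqsubseteq> b\<close>.\<close>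
  moreover have "(a, bzero B) \<in> galois_embedding B a"
    using assms by (simp add: mem_galois_embedding_iff bimonoid_simps)
  ultimately have "(a, bzero B) \<in> galois_embedding B b"
    by (rule subsetD)
  then show "a \<sqsubseteq> b"
    using assms by (simp add: mem_galois_embedding_iff bimonoid_simps)
next
  assume "a \<sqsubseteq> b"
  then show "galois_embedding B a \<subseteq> galois_embedding B b"
    using assms by (auto simp: mem_galois_embedding_iff)
      (meson le_trans plus_closed plus_mono_right)
qed

lemma bimonoid_embedding_galois_embedding:
  "bimonoid_embedding B (galois_bimonoid B) (galois_embedding B)"
proof -
  have "galois_embedding B (bone B) = bone (galois_bimonoid B)"
    by (simp add: galois.one_G galois_embedding_eq_orth_orth bone_closed one_pair_monoid)
  moreover have "galois_embedding B (bzero B) = bzero (galois_bimonoid B)"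
    by (simp add: galois.zero_G galois_embedding_eq_orth one_pair_monoid)
  ultimately show ?thesis
    by (simp add: bimonoid_embedding_def bimonoid_hom_def galois.carrier_G fact_galois_embedding
        galois.le_G galois_embedding_le_iff galois_embedding_mul galois_embedding_plus)
qed

theorem comm_complemented_DM_completion_galois:
  "comm_complemented_DM_completion B (galois_bimonoid B) (galois_embedding B)"
proof -
  let ?G = "galois_bimonoid B" and ?e = "galois_embedding B"
  \<comment> \<open>The families required to be dense are the closures and, below, the orthogonals
    of single pairs. In the second family the pair is swapped, but it still ranges over the whole
    square of the carrier.\<close>
  have mul: "{?e a \<odot>\<^bsub>?G\<^esub> complement ?G (?e b) | a b. a \<in> carrier B \<and> b \<in> carrier B}
      = {pairs.orth (pairs.orth {p}) | p. p \<in> carrier (pair_monoid B)}"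
  proof -
    have "(x = ?e a \<odot>\<^bsub>?G\<^esub> complement ?G (?e b) \<and> a \<in> carrier B \<and> b \<in> carrier B)
        \<longleftrightarrow> (x = pairs.orth (pairs.orth {(a, b)}) \<and> a \<in> carrier B \<and> b \<in> carrier B)" for x a b
      using galois_embedding_mul_complement by auto
    then show ?thesis
      by (auto simp: carrier_pair_monoid)
  qed
  have plus: "{?e a \<oplus>\<^bsub>?G\<^esub> complement ?G (?e b) | a b. a \<in> carrier B \<and> b \<in> carrier B}
      = {pairs.orth {p} | p. p \<in> carrier (pair_monoid B)}"
  proof -
    have "(x = ?e a \<oplus>\<^bsub>?G\<^esub> complement ?G (?e b) \<and> a \<in> carrier B \<and> b \<in> carrier B)
        \<longleftrightarrow> (x = pairs.orth {(b, a)} \<and> a \<in> carrier B \<and> b \<in> carrier B)" for x a b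
      using galois_embedding_plus_complement by auto
    then show ?thesis
      by (auto simp: carrier_pair_monoid)
  qed
  have compl: "\<exists>y. is_complement ?G (?e b) y" if "b \<in> carrier B" for b
    using galois.is_complement_G_iff[OF fact_galois_embedding[OF that]] by blast
  show ?thesis
    unfolding comm_complemented_DM_completion_def comm_Delta1_extension_def mul plus
    by (intro conjI ballI comm_bimonoid_axioms galois.comm_bimonoid_G
        bimonoid_embedding_galois_embedding compl galois.join_dense_G galois.meet_dense_G
        galois.complete_lattice_G galois.complemented_G)
qed

end

section \<open>The lattice-ordered case\<close>

context comm_lbimonoid
begin

lemma meet_pres_galois_embedding: "meet_pres B (galois_bimonoid B) (galois_embedding B)"
  unfolding meet_pres_def
proof (intro conjI ballI)
  fix a b assume ab: "a \<in> carrier B" "b \<in> carrier B"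
  \<comment> \<open>Distributivity of the sum over meets splits the membership condition, so the
    image of a meet is an intersection.\<close>
  have "c \<sqsubseteq> d \<oplus> (a \<sqinter> b) \<longleftrightarrow> c \<sqsubseteq> d \<oplus> a \<and> c \<sqsubseteq> d \<oplus> b"
    if "c \<in> carrier B" "d \<in> carrier B" for c d
    using ab that
    by (simp add: plus_meet_distrib)
      (meson le_trans meet_closed meet_le meet_left meet_right plus_closed)
  then have "galois_embedding B (a \<sqinter> b) = galois_embedding B a \<inter> galois_embedding B b"
    using ab by (auto simp: mem_galois_embedding_iff)
  then show "galois_embedding B (a \<sqinter> b)
      = galois_embedding B a \<sqinter>\<^bsub>galois_bimonoid B\<^esub> galois_embedding B b"
    using ab by (simp add: galois.meet_G fact_galois_embedding)
qed (rule lattice_axioms galois.lattice_G)+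

text \<open>Joins of facts are closures of unions, so orthogonals are compared instead: by
  distributivity of the product over joins, the orthogonal of the generator of
  \<open>a \<squnion> b\<close> is the intersection of those for \<open>a\<close> and
  \<open>b\<close>.\<close>

lemma join_pres_galois_embedding: "join_pres B (galois_bimonoid B) (galois_embedding B)"
  unfolding join_pres_def
proof (intro conjI ballI)
  fix a b assume ab: "a \<in> carrier B" "b \<in> carrier B"
  have "x \<odot> (a \<squnion> b) \<sqsubseteq> y \<longleftrightarrow> x \<odot> a \<sqsubseteq> y \<and> x \<odot> b \<sqsubseteq> y"
    if "x \<in> carrier B" "y \<in> carrier B" for x y
    using ab that
    by (simp add: mul_join_distrib)
      (meson le_trans join_closed join_le join_left join_right mul_closed)
  then have "pairs.orth {(a \<squnion> b, bzero B)} = pairs.orth {(a, bzero B)} \<inter> pairs.orth {(b, bzero B)}"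
    using ab by (auto simp: mem_orth_pairs_iff bimonoid_simps)
  then show "galois_embedding B (a \<squnion> b)
      = galois_embedding B a \<squnion>\<^bsub>galois_bimonoid B\<^esub> galois_embedding B b"
    using ab
    by (simp add: galois.join_G fact_galois_embedding pairs.orth_Un orth_galois_embedding)
       (simp add: galois_embedding_eq_orth_orth)
qed (rule lattice_axioms galois.lattice_G)+

theorem comm_complemented_DM_lcompletion_galois:
  "comm_complemented_DM_lcompletion B (galois_bimonoid B) (galois_embedding B)"
  unfolding comm_complemented_DM_lcompletion_def
  by (intro conjI comm_complemented_DM_completion_galois comm_lbimonoid_axioms
      galois.comm_lbimonoid_G join_pres_galois_embedding meet_pres_galois_embedding)

end

theorem mainTheorem8:
  fixes A :: "('a, 'm) bimonoid_scheme"
  assumes "comm_bimonoid A"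
  shows
    "comm_complemented_DM_completion A (galois_bimonoid A) (galois_embedding A) \<and>
     (\<forall>a\<in>carrier A. galois_embedding A a =
        {(c, d). c \<in> carrier A \<and> d \<in> carrier A \<and> c \<sqsubseteq>\<^bsub>A\<^esub> d \<oplus>\<^bsub>A\<^esub> a}) \<and>
     (\<forall>X\<in>carrier (galois_bimonoid A). \<forall>Y\<in>carrier (galois_bimonoid A).
        X \<sqinter>\<^bsub>galois_bimonoid A\<^esub> Y = X \<inter> Y \<and>
        X \<squnion>\<^bsub>galois_bimonoid A\<^esub> Y = gclosure A (X \<union> Y)) \<and>
     (\<forall>X\<in>carrier (galois_bimonoid A).
        is_complement (galois_bimonoid A) X (galois_compl A X)) \<and>
     (\<exists>(C :: ('a \<times> 'a) set bimonoid) (e :: 'a \<Rightarrow> ('a \<times> 'a) set).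
        comm_complemented_DM_completion A C e) \<and>
     (comm_lbimonoid A \<longrightarrow>
        comm_complemented_DM_lcompletion A (galois_bimonoid A) (galois_embedding A) \<and>
        (\<exists>(C :: ('a \<times> 'a) set bimonoid) (e :: 'a \<Rightarrow> ('a \<times> 'a) set).
           comm_complemented_DM_lcompletion A C e))"
proof -
  interpret comm_bimonoid A by (rule assms)
  let ?G = "galois_bimonoid A" and ?e = "galois_embedding A"
  have l: "comm_complemented_DM_lcompletion A ?G ?e" if "comm_lbimonoid A"
    using comm_lbimonoid.comm_complemented_DM_lcompletion_galois[OF that] .
  have e: "?e a = {(c, d). c \<in> carrier A \<and> d \<in> carrier A \<and> c \<sqsubseteq>\<^bsub>A\<^esub> d \<oplus>\<^bsub>A\<^esub> a}"
    if "a \<in> carrier A" for a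
    using that by (auto simp: mem_galois_embedding_iff)
  have lat: "X \<sqinter>\<^bsub>?G\<^esub> Y = X \<inter> Y \<and> X \<squnion>\<^bsub>?G\<^esub> Y = gclosure A (X \<union> Y)"
    if "X \<in> carrier ?G" "Y \<in> carrier ?G" for X Y
  proof -
    have XY: "pairs.fact X" "pairs.fact Y"
      using that by (simp_all add: galois.carrier_G)
    then have "X \<union> Y \<subseteq> carrier A \<times> carrier A"
      using pairs.fact_closed by (simp add: carrier_pair_monoid)
    with XY show ?thesis
      by (simp add: galois.meet_G galois.join_G gclosure_eq_orth)
  qed
  have c: "is_complement ?G X (galois_compl A X)" if "X \<in> carrier ?G" for X
    using that by (simp add: galois.carrier_G galois.is_complement_G_iff galois_compl_eq_orth)
  show ?thesis
    by (intro conjI ballI impI exI[of _ ?G] exI[of _ ?e] comm_complemented_DM_completion_galois l e c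
        lat[THEN conjunct1] lat[THEN conjunct2])
qed

end
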